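(* Consider the online non-crossing matching problem in which all points have weight $1$, lie on a line, and arrive in arbitrary positions. Then, for inputs of $2n$ points: (1) no randomized online algorithm (without revoking) can achieve a competitive ratio better than $2/n$, i.e., for every randomized online algorithm there is an input of $2n$ points on which the expected number of matched points is at most $\frac{2}{n}$ times the optimum $2n$; and (2) no deterministic online algorithm with revoking can achieve a competitive ratio better than $1/n$, i.e., for every such algorithm there is an input of $2n$ points on which the number of matched points in the final matching is at most $\frac1n\cdot 2n$.
   Context: Collinear online non-crossing matching: points $p_1,\dots,p_{2n}$, all of weight $1$, at distinct positions on a fixed line, arrive online. Upon arrival of a point, the algorithm either leaves it unmatched or matches it with a previously arrived, currently unmatched point, subject to the constraint that the segments (sub-intervals of the line) joining matched pairs are pairwise non-intersecting. Without revoking, matching decisions are irrevocable. With revoking, upon arrival of a new point the algorithm may first irrevocably remove one existing edge from its matching (making its endpoints available) before processing the new point; the profit is the number of points matched in the final matching. The optimum always matches all $2n$ points. *)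

theory Defs
  imports "HOL-Probability.Probability"
begin

text \<open>
  Points are identified with their positions on the line, an edge with the two-element set of its
  endpoints, and an input with the list of positions in order of arrival.
\<close>

text \<open>Segments are closed and are regarded as sets of points of the line, so nested segments
  intersect. Unmatched points may lie on a segment.\<close>

definition noncrossing :: "real set set \<Rightarrow> bool" where
  "noncrossing M \<longleftrightarrow> pairwise (\<lambda>e f. disjnt (convex hull e) (convex hull f)) M"

definition noncrossing_matching :: "real set \<Rightarrow> real set set \<Rightarrow> bool" where
  "noncrossing_matching P M \<longleftrightarrow>
     (\<forall>e\<in>M. e \<subseteq> P \<and> card e = 2) \<and> pairwise disjnt M \<and> noncrossing M"

definition matched_points :: "real set set \<Rightarrow> nat" where
  "matched_points M = card (\<Union>M)"

definition opt :: "real list \<Rightarrow> nat" where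
  "opt ps = Max (matched_points ` {M. noncrossing_matching (set ps) M})"

text \<open>\<open>process P p M M'\<close>: when \<open>p\<close> arrives after the points of \<open>P\<close>, the matching \<open>M\<close> may be
  turned into \<open>M'\<close>.\<close>

definition process :: "real set \<Rightarrow> real \<Rightarrow> real set set \<Rightarrow> real set set \<Rightarrow> bool" where
  "process P p M M' \<longleftrightarrow>
     M' = M \<or> (\<exists>q \<in> P - \<Union>M. M' = insert {p, q} M \<and> noncrossing M')"

text \<open>A deterministic online algorithm is given by the matching it holds after each sequence of
  arrivals; since this depends only on the points arrived so far, it is online.\<close>

type_synonym strategy = "real list \<Rightarrow> real set set"

definition online_algorithm :: "strategy \<Rightarrow> bool" where
  "online_algorithm A \<longleftrightarrow>
     A [] = {} \<and>
     (\<forall>ps p. distinct (ps @ [p]) \<longrightarrow> process (set ps) p (A ps) (A (ps @ [p])))"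

definition revoking_online_algorithm :: "strategy \<Rightarrow> bool" where
  "revoking_online_algorithm A \<longleftrightarrow>
     A [] = {} \<and>
     (\<forall>ps p. distinct (ps @ [p]) \<longrightarrow>
        (\<exists>M. (M = A ps \<or> (\<exists>e \<in> A ps. M = A ps - {e})) \<and>
             process (set ps) p M (A (ps @ [p]))))"

text \<open>A randomized online algorithm is a random deterministic one: the outcome of the probability
  space \<open>R\<close> is the algorithm's random seed. On each input, the matching held is a random
  variable; for a fixed input it takes only finitely many values.\<close>

definition randomized_online_algorithm :: "'r measure \<Rightarrow> ('r \<Rightarrow> strategy) \<Rightarrow> bool" where
  "randomized_online_algorithm R A \<longleftrightarrow>
     prob_space R \<and>
     (\<forall>\<omega> \<in> space R. online_algorithm (A \<omega>)) \<and>
     (\<forall>ps. distinct ps \<longrightarrow> (\<lambda>\<omega>. A \<omega> ps) \<in> R \<rightarrow>\<^sub>M count_space UNIV)"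

end

theory Submission
  imports Defs
begin

text \<open>
  Revoking algorithms: as long as the algorithm holds an edge, the next point is put strictly inside
  its segment, so that no edge can be added without first removing that one.

  Randomized algorithms: the adversary maintains a gap \<open>(l, r)\<close> free of points, inserts its midpoint
  \<open>p\<close>, and continues with one of the two halves. A gap covered by a segment of the matching admits no
  further edges, and if the algorithm matches \<open>p\<close>, then one of the two halves becomes covered. Hence
  the number of edges, plus 2 if the gap is uncovered, does not increase on average over the two
  halves. The adversary knows the distribution of the algorithm and picks the half for which the
  expectation of this potential, initially 2, does not increase.
\<close>

section \<open>Perfect noncrossing matchings and the optimum\<close>

lemma noncrossing_matching_insert:
  assumes M: "noncrossing_matching P M" and "a < b" and above: "\<And>x. x \<in> P \<Longrightarrow> b < x"
  shows "noncrossing_matching (insert a (insert b P)) (insert {a, b} M)"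
proof -
  have edges: "e \<subseteq> P \<and> card e = 2" if "e \<in> M" for e
    using M that by (auto simp: noncrossing_matching_def)
  have "convex hull {a, b} \<subseteq> {..b}"
    using \<open>a < b\<close> by (intro hull_minimal) auto
  moreover have "convex hull e \<subseteq> {b<..}" if "e \<in> M" for e
    using edges[OF that] above by (intro hull_minimal) auto
  ultimately have hulls: "disjnt (convex hull {a, b}) (convex hull e)" if "e \<in> M" for e
    using that by (fastforce simp: disjnt_iff)
  have "disjnt {a, b} e" if "e \<in> M" for e
    using edges[OF that] above \<open>a < b\<close> by (fastforce simp: disjnt_iff)
  moreover have "e \<subseteq> insert a (insert b P)" "card e = 2" if "e \<in> M" for e
    using edges[OF that] by auto
  ultimately show ?thesis
    using M hulls hulls[THEN disjnt_sym] \<open>a < b\<close>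
    by (auto simp: noncrossing_matching_def noncrossing_def pairwise_insert)
qed

text \<open>Neighbouring points are paired: the two smallest points form an edge whose segment lies
  to the left of all the others, and induction handles the rest.\<close>

lemma perfect_noncrossing_matching:
  assumes "finite P" "even (card P)"
  shows "\<exists>M. noncrossing_matching P M \<and> \<Union>M = P"
  using assms
proof (induction "card P" arbitrary: P rule: less_induct)
  case less
  show ?case
  proof (cases "P = {}")
    case True
    then show ?thesis
      by (intro exI[of _ "{}"]) (auto simp: noncrossing_matching_def noncrossing_def)
  next
    case False
    define a where "a = Min P"
    define Q where "Q = P - {a}"
    have a: "a \<in> P" "\<And>x. x \<in> P \<Longrightarrow> a \<le> x"
      using less.prems False by (auto simp: a_def)
    have "P = insert a Q" "a \<notin> Q"
      using a(1) by (auto simp: Q_def)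
    then have Q: "finite Q" "P = insert a Q" "a \<notin> Q" "card P = Suc (card Q)"
      using less.prems(1) by simp_all
    then have "Q \<noteq> {}" using less.prems by auto
    define b where "b = Min Q"
    define P' where "P' = Q - {b}"
    have b: "b \<in> Q" "\<And>x. x \<in> Q \<Longrightarrow> b \<le> x"
      using Q \<open>Q \<noteq> {}\<close> by (auto simp: b_def)
    have "Q = insert b P'" "b \<notin> P'"
      using b(1) by (auto simp: P'_def)
    then have P': "finite P'" "Q = insert b P'" "b \<notin> P'" "card Q = Suc (card P')"
      using Q(1) by simp_all
    have "a < b"
      using a b Q by (metis insertI2 order_le_less)
    have above: "b < x" if "x \<in> P'" for x
      using that b P' by (metis insertI2 order_le_less)
    have "card P' < card P" "even (card P')"
      using Q P' less.prems by auto
    then obtain M where "noncrossing_matching P' M" "\<Union>M = P'"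
      using less.hyps P' by blast
    then have "noncrossing_matching P (insert {a, b} M) \<and> \<Union>(insert {a, b} M) = P"
      using noncrossing_matching_insert[OF _ \<open>a < b\<close> above] Q P' by auto
    then show ?thesis by blast
  qed
qed

lemma opt_eq_length:
  assumes "distinct ps" "even (length ps)"
  shows "opt ps = length ps"
proof -
  have card: "card (set ps) = length ps"
    using assms distinct_card by blast
  obtain M where M: "noncrossing_matching (set ps) M" "\<Union>M = set ps"
    using perfect_noncrossing_matching[of "set ps"] assms card by auto
  have "{M. noncrossing_matching (set ps) M} \<subseteq> Pow (Pow (set ps))"
    by (auto simp: noncrossing_matching_def)
  then have "finite {M. noncrossing_matching (set ps) M}"
    by (rule finite_subset) simp
  moreover have "matched_points M' \<le> length ps" if "noncrossing_matching (set ps) M'" for M'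
    unfolding matched_points_def card[symmetric]
    using that by (intro card_mono) (auto simp: noncrossing_matching_def)
  moreover have "matched_points M = length ps"
    using M card by (simp add: matched_points_def)
  ultimately show ?thesis
    unfolding opt_def using M(1) by (intro Max_eqI) force+
qed

section \<open>Matchings held by online algorithms\<close>

lemma card_insert_le_Suc: "card (insert x A) \<le> Suc (card A)"
  by (cases "finite A") (auto simp: card_insert_if)

lemma matched_points_le:
  assumes "\<forall>e\<in>M. card e = 2"
  shows "matched_points M \<le> 2 * card M"
  using card_Union_le_sum_card[of M] assms by (simp add: matched_points_def)

text \<open>The new segment contains its own endpoint \<open>p\<close>, so any other segment through
  \<open>p\<close> would meet it. That \<open>q\<close> is unmatched ensures that
  \<open>{p, q}\<close> differs from \<open>e\<close>, as \<open>pairwise\<close> only compares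
  distinct edges. Both adversaries block edges through this fact.\<close>

lemma noncrossing_insert_not_in_hull:
  assumes "noncrossing (insert {p, q} M)" "e \<in> M" "q \<notin> \<Union>M"
  shows "p \<notin> convex hull e"
proof
  assume "p \<in> convex hull e"
  moreover have "p \<in> convex hull {p, q}"
    by (simp add: hull_inc)
  moreover have "{p, q} \<noteq> e"
    using assms(2,3) by blast
  then have "disjnt (convex hull {p, q}) (convex hull e)"
    using assms(1,2) unfolding noncrossing_def by (blast dest: pairwiseD)
  ultimately show False by (auto simp: disjnt_iff)
qed

text \<open>Never revoking is a special case, so the invariants of the matching are proved once for
  both models.\<close>

lemma online_imp_revoking:
  "online_algorithm A \<Longrightarrow> revoking_online_algorithm A"
  unfolding online_algorithm_def revoking_online_algorithm_def by blast

lemma revoking_step: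
  assumes "revoking_online_algorithm A" "distinct (ps @ [p])"
  obtains "A (ps @ [p]) \<subseteq> A ps"
  | q where "q \<in> set ps" "A (ps @ [p]) \<subseteq> insert {p, q} (A ps)"
proof -
  obtain M where "M = A ps \<or> (\<exists>e\<in>A ps. M = A ps - {e})"
      and M: "process (set ps) p M (A (ps @ [p]))"
    using assms unfolding revoking_online_algorithm_def by blast
  then have "M \<subseteq> A ps" by auto
  from M show thesis
    unfolding process_def
  proof
    assume "A (ps @ [p]) = M"
    then show thesis using that(1) \<open>M \<subseteq> A ps\<close> by simp
  next
    assume "\<exists>q\<in>set ps - \<Union>M. A (ps @ [p]) = insert {p, q} M \<and> noncrossing (A (ps @ [p]))"
    then obtain q where "q \<in> set ps" "A (ps @ [p]) = insert {p, q} M"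
      by auto
    then show thesis using that(2) \<open>M \<subseteq> A ps\<close> by auto
  qed
qed

text \<open>Finiteness gives bounds on \<open>card\<close> their meaning, since infinite sets have
  \<open>card\<close> 0. The bound by the length later yields integrability.\<close>

lemma revoking_matching:
  assumes "revoking_online_algorithm A" "distinct ps"
  shows "finite (A ps) \<and> card (A ps) \<le> length ps \<and> (\<forall>e\<in>A ps. e \<subseteq> set ps \<and> card e = 2)"
  using assms(2)
proof (induction ps rule: rev_induct)
  case Nil
  then show ?case using assms(1) by (simp add: revoking_online_algorithm_def)
next
  case (snoc p ps)
  then have IH: "finite (A ps)" "card (A ps) \<le> length ps" "\<forall>e\<in>A ps. e \<subseteq> set ps \<and> card e = 2"
    by auto
  from assms(1) snoc.prems show ?case
  proof (cases rule: revoking_step)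
    case 1
    then have "card (A (ps @ [p])) \<le> card (A ps)"
      using IH by (intro card_mono)
    then show ?thesis
      using 1 IH by (auto intro: finite_subset)
  next
    case (2 q)
    then have "p \<noteq> q" using snoc.prems by auto
    have "card (A (ps @ [p])) \<le> card (insert {p, q} (A ps))"
      using 2 IH by (intro card_mono) auto
    also have "\<dots> \<le> Suc (card (A ps))"
      by (rule card_insert_le_Suc)
    finally have "card (A (ps @ [p])) \<le> Suc (card (A ps))" .
    moreover have "finite (A (ps @ [p]))"
      using 2(2) IH(1) by (auto intro: finite_subset)
    moreover have "e \<subseteq> set (ps @ [p]) \<and> card e = 2" if "e \<in> A (ps @ [p])" for e
    proof (cases "e = {p, q}")
      case True
      then show ?thesis using 2(1) \<open>p \<noteq> q\<close> by simp
    next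
      case False
      then have "e \<in> A ps" using that 2(2) by blast
      then show ?thesis using IH(3) by auto
    qed
    ultimately show ?thesis
      using IH(2) by simp
  qed
qed

section \<open>The adversary against revoking algorithms\<close>

lemma revoking_adversary:
  assumes A: "revoking_online_algorithm A"
  shows "\<exists>ps. distinct ps \<and> length ps = k \<and> card (A ps) \<le> 1"
proof (induction k)
  case 0
  then show ?case using A by (auto simp: revoking_online_algorithm_def)
next
  case (Suc k)
  then obtain ps where ps: "distinct ps" "length ps = k" "card (A ps) \<le> 1"
    by blast
  note inv = revoking_matching[OF A ps(1)]
  \<comment> \<open>Without an edge any fresh point will do. Otherwise there is exactly one edge,
    and its segment is infinite while only finitely many points have arrived.\<close>
  obtain p where p: "p \<notin> set ps" "\<forall>e\<in>A ps. p \<in> convex hull e"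
  proof (cases "A ps = {}")
    case True
    then show thesis
      using that ex_new_if_finite[OF infinite_UNIV_char_0, of "set ps"] by auto
  next
    case False
    then obtain e where e: "A ps = {e}"
      using ps(3) inv by (metis card_1_singletonE card_0_eq le_antisym less_one not_le)
    then obtain x y where xy: "e = {x, y}" "x \<noteq> y"
      using inv by (auto simp: card_2_iff)
    then have "infinite (closed_segment x y)"
      by (auto simp: closed_segment_eq_real_ivl infinite_Icc)
    then have "infinite (convex hull e)"
      using xy by (simp add: segment_convex_hull)
    then obtain p where "p \<in> convex hull e" "p \<notin> set ps"
      by (meson List.finite_set finite_subset subsetI)
    then show thesis using that e by auto
  qed
  have dist: "distinct (ps @ [p])" using ps p by simp
  obtain M where M: "M = A ps \<or> (\<exists>e\<in>A ps. M = A ps - {e})"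
      "process (set ps) p M (A (ps @ [p]))"
    using A dist unfolding revoking_online_algorithm_def by blast
  then have "M \<subseteq> A ps" by auto
  then have "card M \<le> 1"
    using ps(3) inv card_mono[of "A ps" M] by linarith
  from M(2) have "card (A (ps @ [p])) \<le> 1"
    unfolding process_def
  proof
    assume "A (ps @ [p]) = M"
    then show ?thesis using \<open>card M \<le> 1\<close> by simp
  next
    assume "\<exists>q\<in>set ps - \<Union>M. A (ps @ [p]) = insert {p, q} M \<and> noncrossing (A (ps @ [p]))"
    then obtain q where q: "q \<notin> \<Union>M" "A (ps @ [p]) = insert {p, q} M"
        "noncrossing (insert {p, q} M)"
      by (metis Diff_iff)
    \<comment> \<open>Any edge left in \<open>M\<close> would belong to \<open>A ps\<close>, and its
      segment would contain \<open>p\<close>. So an edge is added only to an empty matching, and the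
      count stays at most 1.\<close>
    have "M = {}"
      using noncrossing_insert_not_in_hull[OF q(3) _ q(1)] p(2) \<open>M \<subseteq> A ps\<close> by blast
    then show ?thesis using q(2) by simp
  qed
  then show ?case
    using dist ps(2) by (intro exI[of _ "ps @ [p]"]) simp
qed

section \<open>The potential of a gap\<close>

text \<open>The 2 bounds the expected number of further edges if halves were chosen by fair coin
  flips: each match made in an uncovered gap covers the next gap with probability at least 1/2, and
  1 + 1/2 + 1/4 + ... = 2.\<close>

definition potential :: "real \<Rightarrow> real \<Rightarrow> real set set \<Rightarrow> real" where
  "potential l r M =
     real (card M) + (if \<exists>e\<in>M. {l<..<r} \<subseteq> convex hull e then 0 else 2)"

lemma potential_mono:
  assumes "{l'<..<r'} \<subseteq> {l<..<r}"
  shows "potential l' r' M \<le> potential l r M"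
proof (cases "\<exists>e\<in>M. {l<..<r} \<subseteq> convex hull e")
  case True
  then have "\<exists>e\<in>M. {l'<..<r'} \<subseteq> convex hull e"
    using assms by (meson subset_trans)
  with True show ?thesis
    unfolding potential_def by (simp only: if_True)
next
  case False
  then show ?thesis
    unfolding potential_def by (simp only: if_False) simp
qed

text \<open>A new edge adds at most 1 to the edge count in each of the two terms, 2 in total, and
  this is paid for by the half that becomes covered, whose term loses its 2. If \<open>p\<close>
  stays unmatched, monotonicity suffices.\<close>

lemma potential_split:
  assumes "process P p M M'" "P \<inter> {l<..<r} = {}" "l < p" "p < r"
  shows "potential l p M' + potential p r M' \<le> 2 * potential l r M"
  using assms(1) unfolding process_def
proof
  assume "M' = M"
  have "{l<..<p} \<subseteq> {l<..<r}" "{p<..<r} \<subseteq> {l<..<r}"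
    using assms(3,4) by auto
  then have "potential l p M \<le> potential l r M" "potential p r M \<le> potential l r M"
    by (simp_all only: potential_mono)
  then show ?thesis
    using \<open>M' = M\<close> by simp
next
  assume "\<exists>q\<in>P - \<Union>M. M' = insert {p, q} M \<and> noncrossing M'"
  then obtain q where q: "q \<in> P" "q \<notin> \<Union>M" "M' = insert {p, q} M" "noncrossing (insert {p, q} M)"
    by auto
  \<comment> \<open>A segment covering the gap would contain \<open>p\<close>, so a match is
    possible only while the gap still carries its 2.\<close>
  have "\<not> {l<..<r} \<subseteq> convex hull e" if "e \<in> M" for e
    using noncrossing_insert_not_in_hull[OF q(4) that q(2)] assms by auto
  then have M: "potential l r M = real (card M) + 2"
    by (auto simp: potential_def)
  \<comment> \<open>The gap is free of earlier points, so \<open>q\<close> lies beyond one of its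
    ends, and the segment from \<open>p\<close> runs across the half on that side.\<close>
  have "{l<..<p} \<subseteq> convex hull {p, q} \<or> {p<..<r} \<subseteq> convex hull {p, q}"
  proof -
    have "q \<le> l \<or> r \<le> q" using q(1) assms(2) by force
    moreover have "convex hull {p, q} = (if p \<le> q then {p..q} else {q..p})"
      by (simp only: segment_convex_hull[symmetric] closed_segment_eq_real_ivl)
    ultimately show ?thesis
      using assms(3,4) by fastforce
  qed
  then have "potential l p M' + potential p r M' \<le> 2 * real (card M') + 2"
    using q(3) by (auto simp: potential_def)
  also have "\<dots> \<le> 2 * potential l r M"
    using card_insert_le_Suc[of "{p, q}" M] M q(3) by simp
  finally show ?thesis .
qed

section \<open>Inputs generated by repeated halving\<close>

datatype half = Lower | Upper

text \<open>A list of halves records, the latest first, which half of the gap is kept at each arrival. The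
  points arriving under \<open>h # hs\<close> do not depend on \<open>h\<close>.\<close>

fun gap :: "half list \<Rightarrow> real \<times> real" where
  "gap [] = (0, 1)"
| "gap (Lower # hs) = (case gap hs of (l, r) \<Rightarrow> (l, (l + r) / 2))"
| "gap (Upper # hs) = (case gap hs of (l, r) \<Rightarrow> ((l + r) / 2, r))"

fun arrivals :: "half list \<Rightarrow> real list" where
  "arrivals [] = []"
| "arrivals (h # hs) = (case gap hs of (l, r) \<Rightarrow> arrivals hs @ [(l + r) / 2])"

text \<open>Each midpoint becomes an end of the next gap, hence lies outside that open interval, and
  later midpoints are new because they lie inside.\<close>

lemma arrivals_outside_gap:
  assumes "gap hs = (l, r)"
  shows "distinct (arrivals hs) \<and> length (arrivals hs) = length hs \<and> l < r
    \<and> set (arrivals hs) \<inter> {l<..<r} = {}"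
  using assms
proof (induction hs arbitrary: l r)
  case Nil
  then show ?case by simp
next
  case (Cons h hs)
  obtain a b where ab: "gap hs = (a, b)" by fastforce
  define p where "p = (a + b) / 2"
  have IH: "distinct (arrivals hs)" "length (arrivals hs) = length hs" "a < b"
      "set (arrivals hs) \<inter> {a<..<b} = {}"
    using Cons.IH[OF ab] by simp_all
  have p: "a < p" "p < b"
    using IH(3) by (simp_all add: p_def)
  have lr: "(l, r) = (a, p) \<or> (l, r) = (p, b)"
    using Cons.prems by (cases h) (simp_all add: ab p_def)
  then have "l < r" "{l<..<r} \<subseteq> {a<..<b} - {p}"
    using p by auto
  moreover have "p \<in> {a<..<b}" using p by simp
  ultimately have "p \<notin> set (arrivals hs)" "insert p (set (arrivals hs)) \<inter> {l<..<r} = {}"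
    using IH(4) by blast+
  then show ?case
    using IH(1,2) \<open>l < r\<close> by (simp add: ab p_def)
qed

section \<open>Expectations over the random seed\<close>

lemma randomized_matching:
  assumes "randomized_online_algorithm R A" "distinct ps" "\<omega> \<in> space R"
  shows "card (A \<omega> ps) \<le> length ps" "\<forall>e\<in>A \<omega> ps. card e = 2"
proof -
  have "online_algorithm (A \<omega>)"
    using assms(1,3) by (simp add: randomized_online_algorithm_def)
  from revoking_matching[OF online_imp_revoking[OF this] assms(2)]
  show "card (A \<omega> ps) \<le> length ps" "\<forall>e\<in>A \<omega> ps. card e = 2"
    by blast+
qed

context prob_space
begin

lemma randomized_integrable:
  fixes f :: "real set set \<Rightarrow> real"
  assumes "randomized_online_algorithm M A" "distinct ps"
    and "\<And>\<omega>. \<omega> \<in> space M \<Longrightarrow> \<bar>f (A \<omega> ps)\<bar> \<le> B"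
  shows "integrable M (\<lambda>\<omega>. f (A \<omega> ps))"
proof -
  have "(\<lambda>\<omega>. A \<omega> ps) \<in> M \<rightarrow>\<^sub>M count_space UNIV"
    using assms(1,2) by (simp add: randomized_online_algorithm_def)
  \<comment> \<open>Every function on \<open>count_space UNIV\<close> is measurable, so
    \<open>f\<close> is unrestricted here.\<close>
  then have "(\<lambda>\<omega>. f (A \<omega> ps)) \<in> borel_measurable M"
    by (rule measurable_compose) simp
  then show ?thesis
    using assms(3) by (intro integrable_const_bound[where B = B]) auto
qed

lemma integrable_potential:
  assumes "randomized_online_algorithm M A" "distinct ps"
  shows "integrable M (\<lambda>\<omega>. potential l r (A \<omega> ps))"
proof (rule randomized_integrable[OF assms])
  fix \<omega> assume "\<omega> \<in> space M"
  then have "real (card (A \<omega> ps)) \<le> real (length ps)"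
    using randomized_matching(1)[OF assms] by simp
  then show "\<bar>potential l r (A \<omega> ps)\<bar> \<le> real (length ps) + 2"
    by (simp add: potential_def)
qed

text \<open>Each half is chosen by comparing expectations, not outcomes, so \<open>hs\<close> and
  hence the input do not depend on the seed.\<close>

lemma randomized_adversary:
  assumes A: "randomized_online_algorithm M A"
  shows "\<exists>hs l r. length hs = k \<and> gap hs = (l, r) \<and>
           expectation (\<lambda>\<omega>. potential l r (A \<omega> (arrivals hs))) \<le> 2"
proof (induction k)
  case 0
  have "A \<omega> [] = {}" if "\<omega> \<in> space M" for \<omega>
    using A that by (simp add: randomized_online_algorithm_def online_algorithm_def)
  then have "expectation (\<lambda>\<omega>. potential 0 1 (A \<omega> [])) = expectation (\<lambda>\<omega>. 2)"
    by (intro Bochner_Integration.integral_cong) (simp_all add: potential_def)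
  then show ?case
    by (simp add: prob_space)
next
  case (Suc k)
  then obtain hs l r where hs: "length hs = k" and gap: "gap hs = (l, r)"
      and le: "expectation (\<lambda>\<omega>. potential l r (A \<omega> (arrivals hs))) \<le> 2"
    by blast
  define p where "p = (l + r) / 2"
  define ps where "ps = arrivals hs"
  have ps: "distinct ps" "l < r" "set ps \<inter> {l<..<r} = {}"
    using arrivals_outside_gap[OF gap] by (simp_all add: ps_def)
  have p: "l < p" "p < r"
    using ps(2) by (simp_all add: p_def)
  \<comment> \<open>The point arrives before a half is chosen, so both potentials below are
    evaluated on the same matching and can be added pointwise.\<close>
  have next_arrival: "arrivals (h # hs) = ps @ [p]" for h
    by (simp add: gap p_def ps_def)
  have gaps: "gap (Lower # hs) = (l, p)" "gap (Upper # hs) = (p, r)"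
    by (simp_all add: gap p_def)
  have dist: "distinct (ps @ [p])"
    using arrivals_outside_gap[OF gaps(1)] by (simp only: next_arrival)
  note int = integrable_potential[OF A dist] integrable_potential[OF A ps(1)]
  have "potential l p (A \<omega> (ps @ [p])) + potential p r (A \<omega> (ps @ [p])) \<le> 2 * potential l r (A \<omega> ps)"
    if "\<omega> \<in> space M" for \<omega>
  proof (rule potential_split[OF _ ps(3) p])
    show "process (set ps) p (A \<omega> ps) (A \<omega> (ps @ [p]))"
      using A that dist unfolding randomized_online_algorithm_def online_algorithm_def by blast
  qed
  then have "expectation (\<lambda>\<omega>. potential l p (A \<omega> (ps @ [p])) + potential p r (A \<omega> (ps @ [p])))
      \<le> expectation (\<lambda>\<omega>. 2 * potential l r (A \<omega> ps))"
    using int by (intro integral_mono Bochner_Integration.integrable_add integrable_mult_right)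
  then have "expectation (\<lambda>\<omega>. potential l p (A \<omega> (ps @ [p]))) +
      expectation (\<lambda>\<omega>. potential p r (A \<omega> (ps @ [p]))) \<le> 2 * expectation (\<lambda>\<omega>. potential l r (A \<omega> ps))"
    using int by simp
  \<comment> \<open>Two expectations with sum at most 4 cannot both exceed 2.\<close>
  then have "expectation (\<lambda>\<omega>. potential l p (A \<omega> (arrivals (Lower # hs)))) \<le> 2 \<or>
      expectation (\<lambda>\<omega>. potential p r (A \<omega> (arrivals (Upper # hs)))) \<le> 2"
    using le unfolding next_arrival ps_def by linarith
  then show ?case
    using gaps hs by (metis length_Cons)
qed

text \<open>The potential dominates the number of edges, so at most 2 edges are expected, each
  matching two points. The constant 4 is \<open>2 / n\<close> times the optimum
  \<open>2 * n\<close>.\<close>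

lemma randomized_upper_bound:
  assumes A: "randomized_online_algorithm M A"
  shows "\<exists>ps. distinct ps \<and> length ps = k \<and>
           expectation (\<lambda>\<omega>. real (matched_points (A \<omega> ps))) \<le> 4"
proof -
  obtain hs l r where hs: "length hs = k" "gap hs = (l, r)"
      and le: "expectation (\<lambda>\<omega>. potential l r (A \<omega> (arrivals hs))) \<le> 2"
    using randomized_adversary[OF A] by blast
  define ps where "ps = arrivals hs"
  have ps: "distinct ps" "length ps = k"
    using arrivals_outside_gap[OF hs(2)] hs(1) by (simp_all add: ps_def)
  have bound: "matched_points (A \<omega> ps) \<le> 2 * card (A \<omega> ps)" if "\<omega> \<in> space M" for \<omega>
    by (rule matched_points_le[OF randomized_matching(2)[OF A ps(1) that]])
  have "matched_points (A \<omega> ps) \<le> 2 * k" if "\<omega> \<in> space M" for \<omega>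
    using bound[OF that] randomized_matching(1)[OF A ps(1) that] ps(2) by linarith
  then have "\<bar>real (matched_points (A \<omega> ps))\<bar> \<le> real (2 * k)" if "\<omega> \<in> space M" for \<omega>
    using that by (simp del: of_nat_mult)
  then have int: "integrable M (\<lambda>\<omega>. real (matched_points (A \<omega> ps)))"
    by (rule randomized_integrable[OF A ps(1)])
  have "real (matched_points (A \<omega> ps)) \<le> 2 * potential l r (A \<omega> ps)" if "\<omega> \<in> space M" for \<omega>
    using bound[OF that] by (simp add: potential_def)
  then have "expectation (\<lambda>\<omega>. real (matched_points (A \<omega> ps)))
      \<le> expectation (\<lambda>\<omega>. 2 * potential l r (A \<omega> ps))"
    using int integrable_potential[OF A ps(1)] by (intro integral_mono integrable_mult_right)
  also have "\<dots> \<le> 4" using le by (simp add: ps_def)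
  finally show ?thesis using ps by blast
qed

end

theorem theorem14:
  fixes n :: nat
  assumes "n \<ge> 1"
  shows
    "(\<forall>(R :: 'r measure) A. randomized_online_algorithm R A \<longrightarrow>
        (\<exists>ps. distinct ps \<and> length ps = 2 * n \<and> opt ps = 2 * n \<and>
           prob_space.expectation R (\<lambda>\<omega>. real (matched_points (A \<omega> ps)))
             \<le> 2 / real n * real (opt ps)))
     \<and>
     (\<forall>A. revoking_online_algorithm A \<longrightarrow>
        (\<exists>ps. distinct ps \<and> length ps = 2 * n \<and> opt ps = 2 * n \<and>
           real (matched_points (A ps)) \<le> 1 / real n * real (opt ps)))"
proof (intro conjI allI impI)
  fix R :: "'r measure" and A
  assume A: "randomized_online_algorithm R A"
  then have "prob_space R"
    by (simp add: randomized_online_algorithm_def)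
  from prob_space.randomized_upper_bound[OF this A] obtain ps where ps: "distinct ps" "length ps = 2 * n"
      "prob_space.expectation R (\<lambda>\<omega>. real (matched_points (A \<omega> ps))) \<le> 4"
    by blast
  have "opt ps = 2 * n"
    using opt_eq_length ps by simp
  then show "\<exists>ps. distinct ps \<and> length ps = 2 * n \<and> opt ps = 2 * n \<and>
      prob_space.expectation R (\<lambda>\<omega>. real (matched_points (A \<omega> ps))) \<le> 2 / real n * real (opt ps)"
    using ps assms by (intro exI[of _ ps]) simp
next
  fix A
  assume A: "revoking_online_algorithm A"
  then obtain ps where ps: "distinct ps" "length ps = 2 * n" "card (A ps) \<le> 1"
    using revoking_adversary by blast
  have "opt ps = 2 * n"
    using opt_eq_length ps by simp
  \<comment> \<open>A single edge matches two points, and 2 is \<open>1 / n\<close> times the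
    optimum \<open>2 * n\<close>.\<close>
  moreover have "matched_points (A ps) \<le> 2"
    using matched_points_le[of "A ps"] revoking_matching[OF A ps(1)] ps(3) by auto
  ultimately show "\<exists>ps. distinct ps \<and> length ps = 2 * n \<and> opt ps = 2 * n \<and>
      real (matched_points (A ps)) \<le> 1 / real n * real (opt ps)"
    using ps assms by (intro exI[of _ ps]) simp
qed

end
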